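(* Let $d\geq 2$, let $i,j\geq 0$ with $j\leq i-1$, $I=[i,i+d-2]$ and $J=[j,j+d-1]$. If $2\leq r\leq d-1$, then \[ b^I_{J\setminus\{j+r-1\}}=\pi^I_{J\setminus\{j+r-1\}}\; b_{i+d-j-r-1,\,d-r}. \] If $r=1$ or $r=d$, then \[ b^I_{J\setminus\{j\}}=\pi^I_{J\setminus\{j\}}\quad\text{and}\quad b^I_{J\setminus\{j+d-1\}}=\pi^I_{J\setminus\{j+d-1\}}. \]
   Context: For integers $p,q\geq 0$, $b_{p,q}=\binom{p}{q}$, with $b_{p,q}=0$ if $q>p$. For $k\leq l$, $[k,l]=\{k,\ldots,l\}$. For finite sets $I=\{i_1<\cdots<i_m\}$, $J=\{j_1<\cdots<j_m\}$ of non-negative integers, $b^I_J$ is the determinant of the $m\times m$ matrix with $(r,s)$ entry $b_{i_r,j_s}$, and $\pi^I_J=\frac{b_{i_1,j_1}\cdots b_{i_m,j_1}}{b_{j_1,j_1}\cdots b_{j_m,j_1}}$ (a rational number). *)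

theory Defs
  imports "Jordan_Normal_Form.Determinant"
begin

text \<open>The number \<open>b\<^sub>p\<^sub>,\<^sub>q\<close> is \<^term>\<open>p choose q\<close>, which is \<open>0\<close> for \<open>q > p\<close>.
  The minor is only meaningful for finite \<open>I\<close>, \<open>J\<close> with \<^prop>\<open>card I = card J\<close>. Matrix indices
  start at \<open>0\<close>, and it is valued in \<^typ>\<open>rat\<close> for comparison with \<open>binom_pi\<close>.\<close>

definition binom_minor :: "nat set \<Rightarrow> nat set \<Rightarrow> rat" where
  "binom_minor I J =
     det (mat (card I) (card I)
       (\<lambda>(r, s). of_nat ((sorted_list_of_set I ! r) choose (sorted_list_of_set J ! s))))"

text \<open>Here \<^term>\<open>Min J\<close> is the smallest element \<open>j\<^sub>1\<close>, so \<open>J\<close> must be nonempty and finite.\<close>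

definition binom_pi :: "nat set \<Rightarrow> nat set \<Rightarrow> rat" where
  "binom_pi I J =
     (\<Prod>x\<in>I. of_nat (x choose Min J)) / (\<Prod>y\<in>J. of_nat (y choose Min J))"

end

(* After the factors of binom_pi are pulled out of rows and columns, what remains is the minor D
   of the matrix with entries (x + a choose s), a < n, s <= n, that omits column k. By Vandermonde's
   convolution the vector v with entries v s = (- x choose n - s) is annihilated by all n rows, since
   (a choose n) = 0 for a < n. Hence v is proportional to the vector of signed maximal minors; as
   v n = 1 and the minor omitting column n is 1, D = (-1)^(n - k) * (- x choose n - k). *)

theory Submission
  imports Defs "HOL-Computational_Algebra.Formal_Power_Series"
begin

text \<open>For \<open>y > x\<close> both sides vanish, since either \<open>x < q\<close> or
  \<open>x - q < y - q\<close>. The identity therefore covers the zero entries of a minor as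
  well.\<close>

lemma binomial_absorb_min: "q \<le> y \<Longrightarrow> (x choose y) * (y choose q) = (x choose q) * ((x - q) choose (y - q))"
  by (cases "y \<le> x") (auto simp: choose_mult binomial_eq_0)

lemma det_mult_rows_cols:
  fixes f g :: "nat \<Rightarrow> 'a::comm_ring_1"
  shows "det (mat n n (\<lambda>(a, c). f a * M a c * g c)) =
    (\<Prod>a<n. f a) * (\<Prod>c<n. g c) * det (mat n n (\<lambda>(a, c). M a c))"
proof -
  have "det (mat n n (\<lambda>(a, c). f a * M a c * g c)) =
    (\<Sum>p\<in>{p. p permutes {0..<n}}. signof p * (\<Prod>a = 0..<n. f a * M a (p a) * g (p a)))"
    by (auto simp: det_def intro!: sum.cong prod.cong)
  also have "\<dots> = (\<Sum>p\<in>{p. p permutes {0..<n}}. (\<Prod>a<n. f a) * (\<Prod>c<n. g c) *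
      (signof p * (\<Prod>a = 0..<n. M a (p a))))"
  proof (rule sum.cong)
    fix p assume "p \<in> {p. p permutes {0..<n}}"
    then have "(\<Prod>a = 0..<n. g (p a)) = (\<Prod>c = 0..<n. g c)"
      using prod.permute[of p "{0..<n}" g] by (simp add: comp_def)
    then show "signof p * (\<Prod>a = 0..<n. f a * M a (p a) * g (p a)) =
      (\<Prod>a<n. f a) * (\<Prod>c<n. g c) * (signof p * (\<Prod>a = 0..<n. M a (p a)))"
      by (simp add: prod.distrib lessThan_atLeast0 mult_ac)
  qed simp
  also have "\<dots> = (\<Prod>a<n. f a) * (\<Prod>c<n. g c) * det (mat n n (\<lambda>(a, c). M a c))"
    by (auto simp: det_def sum_distrib_left intro!: sum.cong prod.cong)
  finally show ?thesis .
qed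

text \<open>By \<open>binomial_absorb_min\<close> with \<open>q = Min J\<close>, each entry is a row
  factor \<open>x choose q\<close> times a shifted binomial coefficient, divided by a column factor
  \<open>y choose q\<close>. The row factors multiply to the numerator of \<open>binom_pi\<close>,
  the column factors to its denominator.\<close>

lemma binom_minor_factor:
  assumes "finite I" "finite J" "card I = card J"
  shows "binom_minor I J = binom_pi I J * det (mat (card I) (card I)
    (\<lambda>(a, c). of_nat ((sorted_list_of_set I ! a - Min J) choose (sorted_list_of_set J ! c - Min J))))"
proof -
  define n where "n = card I"
  define x y where "x a = sorted_list_of_set I ! a" and "y c = sorted_list_of_set J ! c" for a c
  define q where "q = Min J"
  have bx: "bij_betw x {..<n} I"
    unfolding x_def n_def using assms by (intro bij_betw_nth) auto
  have bij_y: "bij_betw y {..<n} J"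
    unfolding y_def n_def using assms by (intro bij_betw_nth) auto
  have q: "q \<le> y c" if "c < n" for c
    using bij_betwE[OF bij_y] that assms(2) by (auto simp: q_def)
  have entry: "of_nat (x a choose y c) = (of_nat (x a choose q) :: rat) *
      of_nat ((x a - q) choose (y c - q)) * inverse (of_nat (y c choose q))" if "c < n" for a c
  proof -
    have "(of_nat (x a choose y c) :: rat) * of_nat (y c choose q) =
        of_nat (x a choose q) * of_nat ((x a - q) choose (y c - q))"
      using binomial_absorb_min[OF q[OF that], of "x a"] by (metis of_nat_mult)
    moreover have "(of_nat (y c choose q) :: rat) \<noteq> 0"
      using q[OF that] by simp
    ultimately show ?thesis
      by (simp add: field_simps)
  qed
  have "binom_minor I J = det (mat n n (\<lambda>(a, c). (of_nat (x a choose q) :: rat) *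
      of_nat ((x a - q) choose (y c - q)) * inverse (of_nat (y c choose q))))"
    unfolding binom_minor_def x_def[symmetric] y_def[symmetric] n_def[symmetric]
    by (intro arg_cong[where f = det] cong_mat) (auto simp: entry)
  also have "\<dots> = (\<Prod>a<n. of_nat (x a choose q)) * (\<Prod>c<n. inverse (of_nat (y c choose q))) *
      det (mat n n (\<lambda>(a, c). of_nat ((x a - q) choose (y c - q))))"
    by (rule det_mult_rows_cols)
  also have "(\<Prod>a<n. of_nat (x a choose q)) = (\<Prod>a\<in>I. (of_nat (a choose q) :: rat))"
    by (rule prod.reindex_bij_betw[OF bx])
  also have "(\<Prod>c<n. inverse (of_nat (y c choose q))) = (\<Prod>c\<in>J. inverse (of_nat (c choose q) :: rat))"
    by (rule prod.reindex_bij_betw[OF bij_y])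
  finally show ?thesis
    by (simp add: binom_pi_def x_def y_def q_def n_def divide_inverse
      flip: prod_inversef[unfolded comp_def])
qed

text \<open>Vandermonde's convolution factors the matrix as a Pascal matrix times a Toeplitz matrix,
  both triangular with unit diagonal.\<close>

lemma det_gbinomial:
  fixes x :: "'a::field_char_0"
  shows "det (mat n n (\<lambda>(a, s). (x + of_nat a) gchoose s)) = 1"
proof -
  define L :: "'a mat" where "L = mat n n (\<lambda>(a, b). of_nat (a choose b))"
  define U :: "'a mat" where "U = mat n n (\<lambda>(b, s). if b \<le> s then x gchoose (s - b) else 0)"
  have "mat n n (\<lambda>(a, s). (x + of_nat a) gchoose s) = L * U"
  proof (rule eq_matI)
    fix a s assume "a < dim_row (L * U)" "s < dim_col (L * U)"
    then have as: "a < n" "s < n" by (auto simp: L_def U_def)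
    have "(L * U) $$ (a, s) = (\<Sum>b = 0..<n. of_nat (a choose b) * (if b \<le> s then x gchoose (s - b) else 0))"
      using as by (auto simp: L_def U_def scalar_prod_def)
    \<comment> \<open>The entries of \<open>U\<close> vanish for \<open>b > s\<close>, and
      \<open>s < n\<close> keeps all of \<open>0..s\<close> in range, so this is the full
      convolution.\<close>
    also have "\<dots> = (\<Sum>b = 0..s. (of_nat a gchoose b) * (x gchoose (s - b)))"
      using as by (intro sum.mono_neutral_cong_right) (auto simp: binomial_gbinomial)
    also have "\<dots> = (of_nat a + x) gchoose s"
      by (rule gbinomial_Vandermonde)
    finally show "mat n n (\<lambda>(a, s). (x + of_nat a) gchoose s) $$ (a, s) = (L * U) $$ (a, s)"
      using as by (simp add: add.commute)
  qed (auto simp: L_def U_def)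
  moreover have "det L = 1"
    by (subst det_lower_triangular[of n])
       (auto simp: L_def binomial_eq_0 prod_list_diag_prod)
  moreover have "det U = 1"
    by (subst det_upper_triangular[of _ n])
       (auto simp: U_def prod_list_diag_prod)
  moreover have "L \<in> carrier_mat n n" "U \<in> carrier_mat n n"
    by (auto simp: L_def U_def)
  ultimately show ?thesis
    by (simp add: det_mult)
qed

text \<open>Bordering turns the proportionality argument into a product of square matrices. The
  right-hand side is \<open>(-1) ^ (n - k) * ((- x) gchoose (n - k))\<close> with the sign
  absorbed.\<close>

lemma det_gbinomial_skip:
  fixes x :: "'a::field_char_0"
  assumes "k \<le> n"
  shows "det (mat n n (\<lambda>(a, c). (x + of_nat a) gchoose (if c < k then c else Suc c))) =
    (x + of_nat (n - k) - 1) gchoose (n - k)"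
proof -
  \<comment> \<open>The last row is the unit vector at \<open>k\<close>, so expansion along it
    returns, up to sign, the minor that omits column \<open>k\<close>.\<close>
  define A :: "'a mat" where "A = mat (Suc n) (Suc n)
    (\<lambda>(a, s). if a < n then (x + of_nat a) gchoose s else if s = k then 1 else 0)"
  \<comment> \<open>The identity with its last column replaced by the annihilated vector; the corner
    entry is \<open>(- x) gchoose 0 = 1\<close>, so \<open>V\<close> is unitriangular.\<close>
  define V :: "'a mat" where "V = mat (Suc n) (Suc n)
    (\<lambda>(s, c). if c < n then (if s = c then 1 else 0) else (- x) gchoose (n - s))"
  define B where "B = A * V"
  have A: "A \<in> carrier_mat (Suc n) (Suc n)" and V: "V \<in> carrier_mat (Suc n) (Suc n)"
    by (auto simp: A_def V_def)
  then have B: "B \<in> carrier_mat (Suc n) (Suc n)"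
    by (simp add: B_def)
  have B_left: "B $$ (a, c) = A $$ (a, c)" if "a \<le> n" "c < n" for a c
  proof -
    have "B $$ (a, c) = (\<Sum>s = 0..<Suc n. A $$ (a, s) * (if s = c then 1 else 0))"
      using that A V unfolding B_def
      by (auto simp: scalar_prod_def V_def intro!: sum.cong)
    also have "\<dots> = A $$ (a, c)"
      using that by (simp add: if_distrib[of "\<lambda>t. _ * t"] sum.delta cong: if_cong del: sum.op_ivl_Suc)
    finally show ?thesis .
  qed
  have B_last: "B $$ (a, n) = (\<Sum>s = 0..n. A $$ (a, s) * ((- x) gchoose (n - s)))" if "a \<le> n" for a
    using that A V unfolding B_def
    by (auto simp: scalar_prod_def V_def atLeastLessThanSuc_atLeastAtMost intro!: sum.cong)
  have B_zero: "B $$ (a, n) = 0" if "a < n" for a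
  proof -
    have "B $$ (a, n) = (\<Sum>s = 0..n. ((x + of_nat a) gchoose s) * ((- x) gchoose (n - s)))"
      using that by (subst B_last) (auto simp: A_def intro!: sum.cong)
    also have "\<dots> = (x + of_nat a + - x) gchoose n"
      by (rule gbinomial_Vandermonde)
    also have "\<dots> = of_nat (a choose n)"
      by (simp add: binomial_gbinomial)
    finally show ?thesis
      using that by (simp add: binomial_eq_0)
  qed
  have B_corner: "B $$ (n, n) = (- x) gchoose (n - k)"
    using assms by (subst B_last) (auto simp: A_def if_distrib[of "\<lambda>t. t * _"] sum.delta cong: if_cong)
  have del: "mat_delete B n n = mat n n (\<lambda>(a, s). (x + of_nat a) gchoose s)"
    using B by (intro eq_matI) (auto simp: mat_delete_def B_left A_def)
  \<comment> \<open>Only the corner entry of the last column can be nonzero. Its cofactor is the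
    minor on columns \<open>0..<n\<close>, which is 1.\<close>
  have "det B = (\<Sum>a<Suc n. B $$ (a, n) * cofactor B a n)"
    by (rule laplace_expansion_column[OF B]) simp
  also have "\<dots> = ((- x) gchoose (n - k)) * cofactor B n n"
    using B_zero B_corner by simp
  also have "cofactor B n n = 1"
    by (simp add: cofactor_def del det_gbinomial)
  finally have "det B = (- x) gchoose (n - k)"
    by simp
  moreover have "det V = 1"
    by (subst det_upper_triangular[OF _ V])
       (auto simp: V_def prod_list_diag_prod)
  ultimately have "det A = (- x) gchoose (n - k)"
    using det_mult[OF A V] by (simp add: B_def)
  moreover have "det A = (\<Sum>s<Suc n. A $$ (n, s) * cofactor A n s)"
    by (rule laplace_expansion_row[OF A]) simp
  moreover have "\<dots> = (\<Sum>s<Suc n. if s = k then cofactor A n k else 0)"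
    by (rule sum.cong) (auto simp: A_def)
  moreover have "\<dots> = (-1) ^ (n + k) * det (mat_delete A n k)"
    using assms by (simp add: sum.delta cofactor_def del: sum.lessThan_Suc)
  moreover have "mat_delete A n k = mat n n (\<lambda>(a, c). (x + of_nat a) gchoose (if c < k then c else Suc c))"
    using A by (intro eq_matI) (auto simp: mat_delete_def A_def)
  ultimately have "(-1) ^ (n + k) * det (mat n n (\<lambda>(a, c). (x + of_nat a) gchoose (if c < k then c else Suc c)))
      = (-1) ^ (n - k) * ((x + of_nat (n - k) - 1) gchoose (n - k))"
    by (simp add: gbinomial_minus)
  \<comment> \<open>The exponents differ by \<open>2 * k\<close>.\<close>
  moreover have "(-1 :: 'a) ^ (n + k) = (-1) ^ (n - k)"
    using assms by (simp add: minus_one_power_iff)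
  ultimately show ?thesis
    by simp
qed

lemma sorted_list_of_interval_remove:
  assumes "k \<le> n"
  shows "sorted_list_of_set ({j..j + n} - {j + k}) =
    map (\<lambda>c. j + (if c < k then c else Suc c)) [0..<n]" (is "_ = ?l")
proof -
  have "sorted_wrt (<) ?l"
    by (auto simp: sorted_wrt_iff_nth_less)
  moreover have "set ?l = {j..j + n} - {j + k}"
  proof
    show "set ?l \<subseteq> {j..j + n} - {j + k}"
      using assms by (auto split: if_splits)
    show "{j..j + n} - {j + k} \<subseteq> set ?l"
    proof
      fix y assume y: "y \<in> {j..j + n} - {j + k}"
      show "y \<in> set ?l"
      proof (cases "y < j + k")
        case True
        then show ?thesis using y assms
          by (auto intro!: image_eqI[of _ _ "y - j"])
      next
        case False
        \<comment> \<open>Here \<open>y\<close> lies beyond the gap, so its position is one less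
          than its offset \<open>y - j\<close>.\<close>
        then show ?thesis using y assms
          by (auto intro!: image_eqI[of _ _ "y - j - 1"])
      qed
    qed
  qed
  ultimately show ?thesis
    by (metis sorted_list_of_set.idem_if_sorted_distinct strict_sorted_iff)
qed

text \<open>With \<open>0 < k\<close> the element \<open>j\<close> stays, so it is the minimum.
  Admitting \<open>j = i\<close> allows a later use with \<open>Suc j\<close> in place of
  \<open>j\<close> when \<open>j < i\<close>.\<close>

lemma binom_minor_interval_remove:
  assumes "0 < k" "k \<le> n" "j \<le> i"
  shows "binom_minor {i..<i + n} ({j..j + n} - {j + k}) =
    binom_pi {i..<i + n} ({j..j + n} - {j + k}) * of_nat ((i - j + (n - k) - 1) choose (n - k))"
proof -
  let ?J = "{j..j + n} - {j + k}"
  have "Min ?J = j"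
    using assms by (intro Min_eqI) auto
  moreover have "sorted_list_of_set {i..<i + n} ! a - j = i - j + a" if "a < n" for a
    using that assms by simp
  ultimately have "mat n n (\<lambda>(a, c). of_nat ((sorted_list_of_set {i..<i + n} ! a - Min ?J) choose
      (sorted_list_of_set ?J ! c - Min ?J)) :: rat) =
    mat n n (\<lambda>(a, c). (of_nat (i - j) + of_nat a) gchoose (if c < k then c else Suc c))"
    using assms
    by (intro cong_mat)
       (auto simp: sorted_list_of_interval_remove binomial_gbinomial of_nat_diff algebra_simps)
  \<comment> \<open>If \<open>n = k\<close>, the lower index is 0 and both sides are 1, so truncated
    subtraction does no harm; otherwise subtracting 1 does not truncate.\<close>
  moreover have "((of_nat (i - j) + of_nat (n - k) - 1) gchoose (n - k) :: rat) =
      of_nat ((i - j + (n - k) - 1) choose (n - k))"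
    using assms(2) by (cases "n - k") (auto simp: binomial_gbinomial)
  moreover have "card ?J = n"
    using assms by simp
  ultimately show ?thesis
    using assms by (simp add: binom_minor_factor det_gbinomial_skip)
qed

theorem theorem5p2:
  fixes d i j r :: nat and I J :: "nat set"
  assumes "d \<ge> 2"
    and "int j \<le> int i - 1"
    and "I = {i..i + d - 2}"
    and "J = {j..j + d - 1}"
  shows "(2 \<le> r \<and> r \<le> d - 1 \<longrightarrow>
            binom_minor I (J - {j + r - 1}) =
              binom_pi I (J - {j + r - 1}) * of_nat ((i + d - j - r - 1) choose (d - r)))
       \<and> (r = 1 \<or> r = d \<longrightarrow>
            binom_minor I (J - {j}) = binom_pi I (J - {j}) \<and>
            binom_minor I (J - {j + d - 1}) = binom_pi I (J - {j + d - 1}))"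
proof -
  \<comment> \<open>The order of the minors. As \<open>r\<close> counts from 1, the removed offset
    is \<open>k = r - 1\<close>.\<close>
  define n where "n = d - 1"
  have n: "0 < n" "d = Suc n"
    using assms(1) by (auto simp: n_def)
  have I: "I = {i..<i + n}"
    using assms(3) n by auto
  have J: "J = {j..j + n}"
    using assms(4) n by simp
  have ji: "j < i"
    using assms(2) by simp
  \<comment> \<open>Removing \<open>j\<close> changes the minimum, so the remaining set is presented
    as an interval from \<open>Suc j\<close> without its last element.\<close>
  have shift: "J - {j} = {Suc j..Suc j + n} - {Suc j + n}"
    by (auto simp: J)
  have "binom_minor I (J - {j + r - 1}) =
      binom_pi I (J - {j + r - 1}) * of_nat ((i + d - j - r - 1) choose (d - r))"
    if "2 \<le> r" "r \<le> d - 1"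
  proof -
    have "j + r - 1 = j + (r - 1)" "d - r = n - (r - 1)"
        "i + d - j - r - 1 = i - j + (n - (r - 1)) - 1"
      using that n ji by auto
    then show ?thesis
      using binom_minor_interval_remove[of "r - 1" n j i] that n ji by (simp add: I J)
  qed
  \<comment> \<open>In this case and the next one \<open>k = n\<close>, so the binomial factor has
    lower index 0 and equals 1.\<close>
  moreover have "binom_minor I (J - {j}) = binom_pi I (J - {j})"
    unfolding shift I using binom_minor_interval_remove[of n n "Suc j" i] n ji by simp
  moreover have "binom_minor I (J - {j + d - 1}) = binom_pi I (J - {j + d - 1})"
    using binom_minor_interval_remove[of n n j i] n ji by (simp add: I J)
  ultimately show ?thesis
    by blast
qed

end
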